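(* Let $k>0$. The equation $H_k(2x)=2k^{x/k}H_k(x)$ has exactly one solution $x=\alpha_0$ in $[1.5k,\infty)$, and for a real number $\alpha$, the inequality $$k^{y/k}H_k(x)+k^{x/k}H_k(y)\le H_k(x+y)$$ holds for all real numbers $x,y\ge\alpha$ if and only if $\alpha\ge\alpha_0$.
   Context: For $k>0$ and $x>0$, $\Gamma_k(x)=\int_0^\infty t^{x-1}e^{-t^k/k}\,dt=k^{x/k-1}\Gamma(x/k)$; the last expression extends $\Gamma_k$ meromorphically, with $1/\Gamma_k$ entire (equal to $0$ at the poles of $\Gamma_k$). Put $\psi_k=\Gamma_k'/\Gamma_k$. The Hadamard $k$-gamma function is defined for real $x$ by $$H_k(x)=\frac{\psi_k\left(k-\frac x2\right)-\psi_k\left(\frac k2-\frac x2\right)}{2\,\Gamma_k(k-x)},$$ where at the points $x=k,2k,3k,\dots$ (removable singularities) the value is defined by continuity. *)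

theory Defs
  imports "HOL-Analysis.Analysis"
begin

definition k_Gamma :: "real \<Rightarrow> real \<Rightarrow> real" where
  "k_Gamma k x = k powr (x / k - 1) * Gamma (x / k)"

text \<open>The closed form above agrees with the defining integral for positive arguments and
  provides its extension to the other arguments.\<close>

lemma k_Gamma_integral:
  assumes k: "k > 0" and x: "x > 0"
  shows "((\<lambda>t. t powr (x - 1) * exp (- (t powr k) / k)) has_integral k_Gamma k x) {0<..}"
proof -
  define f where "f = (\<lambda>u::real. u powr (x / k - 1) / exp u)"
  define g where "g = (\<lambda>t::real. t powr k / k)"
  have "(f has_integral Gamma (x / k)) {0..}"
    unfolding f_def using k x by (intro Gamma_integral_real) auto
  then have fi: "(f has_integral Gamma (x / k)) {0<..}"
    by (rule has_integral_spike_set_eq[THEN iffD1, rotated 2])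
       (auto intro!: negligible_subset[OF negligible_sing[of 0]])
  have "f absolutely_integrable_on {0<..}"
    using fi by (intro nonnegative_absolutely_integrable_1) (auto simp: f_def)
  moreover have img: "g ` {0<..} = {0<..}"
  proof (intro equalityI subsetI)
    fix u :: real assume "u \<in> {0<..}"
    then have "u = g ((k * u) powr (1 / k))" "(k * u) powr (1 / k) \<in> {0<..}"
      using k by (auto simp: g_def powr_powr)
    then show "u \<in> g ` {0<..}" by blast
  qed (use k in \<open>auto simp: g_def\<close>)
  moreover have "inj_on g {0<..}"
  proof (rule inj_onI)
    fix s t assume "s \<in> {0<..}" "t \<in> {0<..}" "g s = g t"
    then have "(s powr k) powr (1 / k) = (t powr k) powr (1 / k)"
      using k by (simp add: g_def)
    with \<open>s \<in> {0<..}\<close> \<open>t \<in> {0<..}\<close> show "s = t" using k by (simp add: powr_powr)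
  qed
  moreover have "(g has_field_derivative t powr (k - 1)) (at t within {0<..})" if "t \<in> {0<..}" for t
    unfolding g_def using that k by (auto intro!: derivative_eq_intros)
  ultimately have "(\<lambda>t. \<bar>t powr (k - 1)\<bar> * f (g t)) absolutely_integrable_on {0<..} \<and>
      integral {0<..} (\<lambda>t. \<bar>t powr (k - 1)\<bar> * f (g t)) = Gamma (x / k)"
    using fi by (subst has_absolute_integral_change_of_variables_1') (auto simp: integral_unique)
  then have "((\<lambda>t. \<bar>t powr (k - 1)\<bar> * f (g t)) has_integral Gamma (x / k)) {0<..}"
    by (metis absolutely_integrable_on_def integrable_integral)
  then have "((\<lambda>t. k powr (x / k - 1) * (\<bar>t powr (k - 1)\<bar> * f (g t))) has_integral
      k_Gamma k x) {0<..}"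
    unfolding k_Gamma_def by (rule has_integral_mult_right)
  then show ?thesis
  proof (rule has_integral_eq[rotated])
    fix t :: real assume "t \<in> {0<..}"
    then have t: "t > 0" by simp
    have "g t powr (x / k - 1) = t powr (x - k) / k powr (x / k - 1)"
    proof -
      have "k * (x / k - 1) = x - k" using k by (simp add: field_simps)
      then show ?thesis using t k by (simp add: g_def powr_divide powr_powr)
    qed
    then have "k powr (x / k - 1) * g t powr (x / k - 1) = t powr (x - k)"
      using k by simp
    moreover have "t powr (k - 1) * t powr (x - k) = t powr (x - 1)"
      by (simp flip: powr_add)
    ultimately have "k powr (x / k - 1) * g t powr (x / k - 1) * t powr (k - 1) = t powr (x - 1)"
      by (simp add: mult.commute)
    moreover have "f (g t) = g t powr (x / k - 1) * exp (- (t powr k) / k)"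
      by (simp add: f_def g_def exp_minus divide_inverse)
    ultimately show "k powr (x / k - 1) * (\<bar>t powr (k - 1)\<bar> * f (g t)) =
        t powr (x - 1) * exp (- (t powr k) / k)"
      by (simp add: mult_ac) 
  qed
qed

definition k_psi :: "real \<Rightarrow> real \<Rightarrow> real" where
  "k_psi k x = deriv (k_Gamma k) x / k_Gamma k x"

definition k_Hadamard_raw :: "real \<Rightarrow> real \<Rightarrow> real" where
  "k_Hadamard_raw k x =
     (k_psi k (k - x / 2) - k_psi k (k / 2 - x / 2)) / (2 * k_Gamma k (k - x))"

text \<open>At the removable singularities \<open>k, 2k, 3k, \<dots>\<close> the raw formula involves poles of the
  functions above, where their HOL values are meaningless; there the value is the limit.\<close>

definition k_Hadamard :: "real \<Rightarrow> real \<Rightarrow> real" where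
  "k_Hadamard k x =
     (if \<exists>n::nat. n \<ge> 1 \<and> x = real n * k then Lim (at x) (k_Hadamard_raw k)
      else k_Hadamard_raw k x)"

end

theory Submission
  imports Defs
begin

text \<open>
  By homogeneity everything reduces to \<open>k = 1\<close>. The reflection formulas for \<open>\<Gamma>\<close> and \<open>\<psi>\<close> give
  \<open>H(x) = \<Gamma>(x) (1 - sin(\<pi>x) \<beta>(x) / \<pi>)\<close> for \<open>x > 0\<close>, where
  \<open>\<beta>(x) = (\<psi>((x+1)/2) - \<psi>(x/2)) / 2\<close> is positive and satisfies \<open>\<beta>(x) + \<beta>(x+1) = 1/x\<close>.
  Although \<open>H\<close> is not convex on \<open>[3/2, \<infinity>)\<close>, simple bounds on \<open>\<beta>\<close> and \<open>\<beta>'\<close> show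
  \<open>H'(w) > H'(y)\<close> whenever \<open>y \<ge> 3/2\<close> and \<open>w \<ge> y + 3/2\<close>. Hence \<open>H(2x) - 2H(x)\<close> is strictly
  increasing on \<open>[3/2, \<infinity>)\<close>; it is negative at \<open>3/2\<close> since \<open>(\<surd>\<pi> - 2)\<^sup>2 > 0\<close>, and positive at
  \<open>2\<close>. Likewise \<open>H(x+y) - H(x) - H(y)\<close> increases in \<open>y\<close> for \<open>x, y \<ge> 3/2\<close>, so that
  its sign is decided on the diagonal.
\<close>

section \<open>Reflection formulas on the real line\<close>

lemma pos_notin_nonpos_Ints: "0 < x \<Longrightarrow> (x::real) \<notin> \<int>\<^sub>\<le>\<^sub>0"
  by (auto elim!: nonpos_Ints_cases)

lemma one_minus_notin_nonpos_Ints: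
  assumes "x \<notin> \<int>"
  shows "1 - (x::real) \<notin> \<int>\<^sub>\<le>\<^sub>0"
proof
  assume "1 - x \<in> \<int>\<^sub>\<le>\<^sub>0"
  then have "1 - (1 - x) \<in> \<int>"
    using nonpos_Ints_subset_Ints by (intro Ints_diff) auto
  with assms show False by simp
qed

text \<open>Includes the integers: there \<open>Gamma\<close> is 0 at one of the two arguments and
  division by \<open>sin (pi * x) = 0\<close> gives 0. The identity can thus be differentiated as an
  equation of functions.\<close>

lemma Gamma_reflection_real: "Gamma x * Gamma (1 - x) = pi / sin (pi * x)" for x :: real
proof -
  have "complex_of_real (Gamma x * Gamma (1 - x)) = of_real (pi / sin (pi * x))"
    using Gamma_reflection_complex[of "of_real x"]
    by (simp flip: Gamma_complex_of_real sin_of_real)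
  then show ?thesis by (simp only: of_real_eq_iff)
qed

lemma sin_pi_times_nonzero: "x \<notin> \<int> \<Longrightarrow> sin (pi * x) \<noteq> 0"
  by (auto simp: sin_zero_iff_int2)

text \<open>Logarithmic derivative of the reflection formula for \<open>Gamma\<close>.\<close>

lemma Digamma_reflection_real:
  fixes x :: real
  assumes x: "x \<notin> \<int>"
  shows "Digamma (1 - x) = Digamma x + pi * cos (pi * x) / sin (pi * x)"
proof -
  have s: "sin (pi * x) \<noteq> 0"
    using x by (rule sin_pi_times_nonzero)
  have n: "x \<notin> \<int>\<^sub>\<le>\<^sub>0" "1 - x \<notin> \<int>\<^sub>\<le>\<^sub>0"
    using x nonpos_Ints_subset_Ints one_minus_notin_nonpos_Ints by auto
  define G where "G = Gamma x * Gamma (1 - x)"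
  have G: "G = pi / sin (pi * x)" "G \<noteq> 0"
    unfolding G_def Gamma_reflection_real using s by simp_all
  have "((\<lambda>x. Gamma x * Gamma (1 - x)) has_field_derivative G * (Digamma x - Digamma (1 - x))) (at x)"
    unfolding G_def using n
    by (auto intro!: derivative_eq_intros DERIV_chain2[OF has_field_derivative_Gamma] simp: algebra_simps)
  moreover have "((\<lambda>x. pi / sin (pi * x)) has_field_derivative
      G * (- pi * cos (pi * x) / sin (pi * x))) (at x)"
    unfolding G(1) using s by (auto intro!: derivative_eq_intros simp: field_simps power2_eq_square)
  ultimately have "G * (Digamma x - Digamma (1 - x)) = G * (- pi * cos (pi * x) / sin (pi * x))"
    unfolding Gamma_reflection_real by (rule DERIV_unique)
  then show ?thesis
    using G(2) unfolding mult_left_cancel[OF G(2)] by simp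
qed

section \<open>The Nielsen beta function\<close>

text \<open>Known as the sum of (-1)^n / (x + n) over n \<ge> 0, which explains the recurrence
  between its values at x and x + 1.\<close>

definition nielsen_beta :: "real \<Rightarrow> real" where
  "nielsen_beta x = (Digamma ((x + 1) / 2) - Digamma (x / 2)) / 2"

definition nielsen_beta' :: "real \<Rightarrow> real" where
  "nielsen_beta' x = (Polygamma 1 ((x + 1) / 2) - Polygamma 1 (x / 2)) / 4"

lemma has_field_derivative_nielsen_beta:
  assumes "x > 0"
  shows "(nielsen_beta has_field_derivative nielsen_beta' x) (at x)"
  unfolding nielsen_beta_def nielsen_beta'_def
  using assms by (auto intro!: derivative_eq_intros DERIV_chain2[OF has_field_derivative_Polygamma] pos_notin_nonpos_Ints)

lemma nielsen_beta_pos: "x > 0 \<Longrightarrow> nielsen_beta x > 0"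
  using Digamma_real_strict_mono[of "x / 2" "(x + 1) / 2"] by (simp add: nielsen_beta_def)

lemma nielsen_beta'_neg: "x > 0 \<Longrightarrow> nielsen_beta' x < 0"
  using Polygamma_real_strict_antimono[of "x / 2" "(x + 1) / 2" 1] by (simp add: nielsen_beta'_def)

lemma nielsen_beta_plus1:
  assumes "x > 0"
  shows "nielsen_beta (x + 1) = 1 / x - nielsen_beta x"
proof -
  have *: "(x + 1 + 1) / 2 = x / 2 + 1" by simp
  show ?thesis
    unfolding nielsen_beta_def * using assms
    by (subst Digamma_plus1) (auto simp: field_simps)
qed

lemma nielsen_beta'_plus1:
  assumes "x > 0"
  shows "nielsen_beta' (x + 1) = - 1 / x\<^sup>2 - nielsen_beta' x"
proof -
  have *: "(x + 1 + 1) / 2 = x / 2 + 1" by simp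
  show ?thesis
    unfolding nielsen_beta'_def * using assms
    by (subst Polygamma_plus1) (auto simp: field_simps power2_eq_square)
qed

lemma nielsen_beta_strict_antimono: "0 < x \<Longrightarrow> x < y \<Longrightarrow> nielsen_beta y < nielsen_beta x"
  by (rule DERIV_neg_imp_decreasing)
     (auto intro!: exI[of _ "nielsen_beta' _"] has_field_derivative_nielsen_beta nielsen_beta'_neg)

text \<open>Monotonicity and the recurrence at x + 1 give
  \<open>nielsen_beta (x + 1) \<ge> 1 / (2 * (x + 1))\<close>; the recurrence at x turns this lower
  bound into an upper one.\<close>

lemma nielsen_beta_le:
  assumes "x > 0"
  shows "nielsen_beta x \<le> 1 / (2 * x) + 1 / (2 * x * (x + 1))"
proof -
  have "1 / (x + 1) = nielsen_beta (x + 1) + nielsen_beta (x + 2)"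
    using nielsen_beta_plus1[of "x + 1"] assms by (simp add: add.assoc)
  also have "\<dots> \<le> 2 * nielsen_beta (x + 1)"
    using nielsen_beta_strict_antimono[of "x + 1" "x + 2"] assms by simp
  finally have le: "1 / (x + 1) \<le> 2 * (1 / x - nielsen_beta x)"
    unfolding nielsen_beta_plus1[OF assms] .
  have "1 / x - 1 / (x + 1) = 1 / (x * (x + 1))"
    using assms by (simp add: field_simps)
  moreover have "b \<le> u / 2 + w / 2" if "v \<le> 2 * (u - b)" "u - v = w" for b u v w :: real
    using that by simp
  ultimately have "nielsen_beta x \<le> 1 / x / 2 + 1 / (x * (x + 1)) / 2"
    using le by blast
  then show ?thesis by (simp add: mult_ac)
qed

text \<open>Negativity at x + 1, carried to x by the recurrence.\<close>

lemma nielsen_beta'_ge: "x > 0 \<Longrightarrow> nielsen_beta' x \<ge> - 1 / x\<^sup>2"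
  using nielsen_beta'_plus1[of x] nielsen_beta'_neg[of "x + 1"] by simp

section \<open>The Hadamard gamma function on the positive half-line\<close>

text \<open>For positive x this is the case k = 1, written without singularities at the integers;
  \<open>k_Hadamard_eq\<close> makes the connection.\<close>

definition Hadamard :: "real \<Rightarrow> real" where
  "Hadamard x = Gamma x * (1 - sin (pi * x) * nielsen_beta x / pi)"

definition Hadamard' :: "real \<Rightarrow> real" where
  "Hadamard' x = Gamma x * (Digamma x * (1 - sin (pi * x) * nielsen_beta x / pi)
     - cos (pi * x) * nielsen_beta x - sin (pi * x) * nielsen_beta' x / pi)"

lemma has_field_derivative_Hadamard:
  assumes "x > 0"
  shows "(Hadamard has_field_derivative Hadamard' x) (at x)"
  unfolding Hadamard_def Hadamard'_def using assms
  by (auto intro!: derivative_eq_intros DERIV_chain2[OF has_field_derivative_nielsen_beta] pos_notin_nonpos_Ints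
      simp: field_simps)

lemma continuous_Hadamard: "x > 0 \<Longrightarrow> isCont Hadamard x"
  using DERIV_isCont[OF has_field_derivative_Hadamard] .

lemma Hadamard_Suc: "Hadamard (real (Suc n)) = fact n"
proof -
  have "sin (pi * real (Suc n)) = 0"
    by (metis mult.commute sin_npi)
  moreover have "Gamma (real (Suc n)) = fact n"
    using Gamma_fact[of n, where 'a = real] by (simp add: add.commute)
  ultimately show ?thesis unfolding Hadamard_def by simp
qed

lemma Hadamard_three_halves: "Hadamard (3/2) = (4 + pi) / (4 * sqrt pi)"
proof -
  \<comment> \<open>Reflection links 3/4 to 1/4 and the shift by 1 links 5/4 to 1/4, so the unknown
    \<open>Digamma (1/4)\<close> cancels in \<open>nielsen_beta (3/2)\<close>.\<close>
  have "(1/4 :: real) \<notin> \<int>"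
    using fraction_not_in_Ints[where 'a = real, of 4 1] by simp
  from Digamma_reflection_real[OF this]
  have "Digamma (3/4 :: real) = Digamma (1/4) + pi"
    by (simp add: cos_45 sin_45)
  moreover have "Digamma (5/4 :: real) = Digamma (1/4) + 4"
    using Digamma_plus1[of "1/4 :: real"] by simp
  ultimately have "nielsen_beta (3/2) = (4 - pi) / 2"
    by (simp add: nielsen_beta_def)
  moreover have "sin (pi * (3/2)) = -1"
    using sin_3over2_pi by (simp only: mult.commute)
  moreover have "Gamma (3/2 :: real) = sqrt pi / 2"
    using Gamma_plus1[OF pos_notin_nonpos_Ints, of "1/2"] by (simp add: Gamma_one_half_real)
  ultimately have "Hadamard (3/2) = sqrt pi / 2 * (1 - -1 * ((4 - pi) / 2) / pi)"
    unfolding Hadamard_def by (simp only:)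
  also have "\<dots> = sqrt pi * ((4 + pi) / (4 * (sqrt pi * sqrt pi)))"
    by (simp add: field_simps)
  also have "\<dots> = (4 + pi) / (4 * sqrt pi)"
    by (simp del: real_sqrt_mult_self)
  finally show ?thesis .
qed

section \<open>The derivative of the Hadamard gamma function\<close>

lemma Gamma_real_mono_ge_three_halves:
  assumes "3/2 \<le> x" "x \<le> y"
  shows "Gamma x \<le> (Gamma y :: real)"
  using assms(2)
proof (rule DERIV_nonneg_imp_nondecreasing)
  fix t assume "x \<le> t" "t \<le> y"
  with assms have "(Gamma has_field_derivative Gamma t * Digamma t) (at t)" "Gamma t * Digamma t \<ge> 0"
    using Digamma_real_ge_three_halves_pos[of t]
    by (auto intro!: derivative_eq_intros pos_notin_nonpos_Ints mult_nonneg_nonneg less_imp_le[of 0])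
  then show "\<exists>d. (Gamma has_real_derivative d) (at t) \<and> 0 \<le> d" by blast
qed

text \<open>Mean value theorem on [y + 1, w]: the length is at least 1/2 and \<open>Digamma\<close>
  at least 2/3, so \<open>Gamma (y + 1) = y * Gamma y\<close> grows by a factor of at least 1 +
  1/3.\<close>

lemma Gamma_lower_bound:
  assumes y: "y \<ge> 3/2" and w: "w \<ge> y + 3/2"
  shows "Gamma w \<ge> 4/3 * y * (Gamma y :: real)"
proof -
  have "\<exists>z. y + 1 < z \<and> z < w \<and> Gamma w - Gamma (y + 1) = (w - (y + 1)) * (Gamma z * Digamma z)"
    using assms by (intro MVT2 has_field_derivative_Gamma pos_notin_nonpos_Ints) auto
  then obtain z where z: "y + 1 < z" "z < w"
    and eq: "Gamma w - Gamma (y + 1) = (w - (y + 1)) * (Gamma z * Digamma z)" by blast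
  have "2 / 3 \<le> Digamma (5/2 :: real)"
    using Digamma_plus1[of "3/2 :: real"] Digamma_real_three_halves_pos by simp
  also have "\<dots> \<le> Digamma z"
    using z y by (intro Digamma_real_mono) auto
  finally have D: "2 / 3 \<le> Digamma z" .
  have G: "Gamma (y + 1) \<le> Gamma z" "0 < Gamma (y + 1)"
    using y z by (auto intro!: Gamma_real_mono_ge_three_halves)
  have "1/2 * (Gamma (y + 1) * (2 / 3)) \<le> (w - (y + 1)) * (Gamma z * Digamma z)"
    using w D G by (intro mult_mono) auto
  with eq have "Gamma w \<ge> 4/3 * Gamma (y + 1)" by simp
  moreover have "Gamma (y + 1) = y * Gamma y"
    using y by (intro Gamma_plus1) (auto elim!: nonpos_Ints_cases)
  ultimately show ?thesis by simp
qed

section \<open>Bounds on \<open>Hadamard'\<close>\<close>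

lemma beta_term_bounds:
  assumes x: "x > 0" and b: "nielsen_beta x \<le> b"
  shows "\<bar>sin (pi * x) * nielsen_beta x / pi\<bar> \<le> b / 3"
    and "\<bar>cos (pi * x) * nielsen_beta x\<bar> \<le> b"
    and "\<bar>sin (pi * x) * nielsen_beta' x / pi\<bar> \<le> 1 / (3 * x\<^sup>2)"
proof -
  have \<beta>: "\<bar>nielsen_beta x\<bar> \<le> b" and \<beta>': "\<bar>nielsen_beta' x\<bar> \<le> 1 / x\<^sup>2"
    using b nielsen_beta_pos[OF x] nielsen_beta'_neg[OF x] nielsen_beta'_ge[OF x] by auto
  have scale: "\<bar>sin (pi * x) * t / pi\<bar> \<le> m / 3" if "\<bar>t\<bar> \<le> m" for t m
  proof -
    have "\<bar>sin (pi * x)\<bar> * \<bar>t\<bar> \<le> 1 * m"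
      using that by (intro mult_mono) auto
    moreover have "0 \<le> m" using that by linarith
    ultimately have "\<bar>sin (pi * x)\<bar> * \<bar>t\<bar> / pi \<le> m / 3"
      using pi_gt3 by (intro frac_le) auto
    then show ?thesis by (simp add: abs_mult)
  qed
  show "\<bar>sin (pi * x) * nielsen_beta x / pi\<bar> \<le> b / 3"
    using \<beta> by (rule scale)
  show "\<bar>sin (pi * x) * nielsen_beta' x / pi\<bar> \<le> 1 / (3 * x\<^sup>2)"
    using scale[OF \<beta>'] by simp
  have "\<bar>cos (pi * x)\<bar> * \<bar>nielsen_beta x\<bar> \<le> 1 * b"
    using \<beta> by (intro mult_mono) auto
  then show "\<bar>cos (pi * x) * nielsen_beta x\<bar> \<le> b"
    by (simp add: abs_mult)
qed

text \<open>Every oscillating term is given its worst sign; \<open>Digamma\<close> is positive from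
  3/2 on, so the estimate survives multiplication by it.\<close>

lemma Hadamard'_upper_bound:
  assumes y: "y \<ge> 3/2" and b: "nielsen_beta y \<le> b"
  shows "Hadamard' y \<le> Gamma y * (Digamma y * (1 + b / 3) + b + 1 / (3 * y\<^sup>2))"
proof -
  define s c \<beta> \<beta>' where "s = sin (pi * y)" and "c = cos (pi * y)"
    and "\<beta> = nielsen_beta y" and "\<beta>' = nielsen_beta' y"
  have bounds: "- (s * \<beta> / pi) \<le> b / 3" "- (c * \<beta>) \<le> b" "- (s * \<beta>' / pi) \<le> 1 / (3 * y\<^sup>2)"
    using beta_term_bounds[OF _ b] y unfolding s_def c_def \<beta>_def \<beta>'_def by linarith+
  have "Digamma y * (1 - s * \<beta> / pi) \<le> Digamma y * (1 + b / 3)"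
    using bounds(1) Digamma_real_ge_three_halves_pos[OF y] by (intro mult_left_mono) auto
  with bounds(2,3) have "Digamma y * (1 - s * \<beta> / pi) - c * \<beta> - s * \<beta>' / pi
      \<le> Digamma y * (1 + b / 3) + b + 1 / (3 * y\<^sup>2)"
    by linarith
  with y show ?thesis
    unfolding Hadamard'_def s_def c_def \<beta>_def \<beta>'_def by (intro mult_left_mono) auto
qed

lemma Hadamard'_lower_bound:
  assumes w: "w \<ge> 3/2" and b: "nielsen_beta w \<le> b"
  shows "Hadamard' w \<ge> Gamma w * (Digamma w * (1 - b / 3) - b - 1 / (3 * w\<^sup>2))"
proof -
  define s c \<beta> \<beta>' where "s = sin (pi * w)" and "c = cos (pi * w)"
    and "\<beta> = nielsen_beta w" and "\<beta>' = nielsen_beta' w"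
  have bounds: "s * \<beta> / pi \<le> b / 3" "c * \<beta> \<le> b" "s * \<beta>' / pi \<le> 1 / (3 * w\<^sup>2)"
    using beta_term_bounds[OF _ b] w unfolding s_def c_def \<beta>_def \<beta>'_def by linarith+
  have "Digamma w * (1 - s * \<beta> / pi) \<ge> Digamma w * (1 - b / 3)"
    using bounds(1) Digamma_real_ge_three_halves_pos[OF w] by (intro mult_left_mono) auto
  with bounds(2,3) have "Digamma w * (1 - s * \<beta> / pi) - c * \<beta> - s * \<beta>' / pi
      \<ge> Digamma w * (1 - b / 3) - b - 1 / (3 * w\<^sup>2)"
    by linarith
  with w show ?thesis
    unfolding Hadamard'_def s_def c_def \<beta>_def \<beta>'_def by (intro mult_left_mono) auto
qed

text \<open>The bounds give \<open>Hadamard' y \<le> Gamma y * U\<close> and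
  \<open>Hadamard' w \<ge> Gamma w * L\<close>; by \<open>Gamma_lower_bound\<close> it suffices that
  \<open>U < 4/3 * y * L\<close> and \<open>0 < L\<close>.\<close>

lemma Hadamard'_less:
  assumes y: "y \<ge> 3/2" and w: "w \<ge> y + 3/2"
  shows "Hadamard' y < Hadamard' w"
proof -
  \<comment> \<open>\<open>v\<close> is the smallest admissible \<open>w\<close>, where the error
    terms of the lower bound are largest; \<open>p + 1 / y\<close> in \<open>L\<close> is
    \<open>Digamma (y + 1)\<close>, which is at most \<open>Digamma w\<close>.\<close>
  define v where "v = y + 3/2"
  define b where "b = 1 / (2 * y) + 1 / (2 * y * (y + 1))"
  define c where "c = 1 / (2 * v) + 1 / (2 * v * (v + 1))"
  define p where "p = Digamma y"
  define L where "L = (p + 1 / y) * (1 - c / 3) - c - 1 / (3 * v\<^sup>2)"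
  define U where "U = p * (1 + b / 3) + b + 1 / (3 * y\<^sup>2)"
  have v: "3 \<le> v" "v \<le> w"
    using y w by (simp_all add: v_def)
  have p: "p \<ge> 0"
    using Digamma_real_ge_three_halves_pos[OF y] by (simp add: p_def)
  have "b \<le> 1 / (2 * (3/2)) + 1 / (2 * (3/2) * (3/2 + 1))"
    unfolding b_def using y by (intro add_mono frac_le mult_mono) auto
  then have b: "b \<le> 7/15" by simp
  have "c \<le> 1 / (2 * 3) + 1 / (2 * 3 * (3 + 1))"
    unfolding c_def using v by (intro add_mono frac_le mult_mono) auto
  then have c: "c \<le> 5/24" by simp
  \<comment> \<open>The bound \<open>6 * y \<le> v\<^sup>2\<close> is the inequality of arithmetic
    and geometric means for y and 3/2.\<close>
  have v2: "y / (3 * v\<^sup>2) \<le> 1/18"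
  proof -
    have "v\<^sup>2 - 6 * y = (y - 3/2)\<^sup>2"
      by (simp add: v_def power2_eq_square algebra_simps)
    then have "6 * y \<le> v\<^sup>2"
      using zero_le_power2[of "y - 3/2"] by linarith
    then show ?thesis using v by (simp add: field_simps)
  qed
  have "c = (v + 1) / (2 * (v * (v + 1))) + 1 / (2 * (v * (v + 1)))"
    using v by (simp add: c_def)
  also have "\<dots> = (v + 2) / (2 * (v * (v + 1)))"
    unfolding add_divide_distrib[symmetric] by (simp add: add.assoc)
  finally have "c = (v + 2) / (2 * (v * (v + 1)))" .
  moreover have "v + 2 = y + 7/2" "v + 1 = y + 5/2"
    by (simp_all add: v_def)
  ultimately have yc: "y * c = y * (y + 7/2) / (2 * ((y + 3/2) * (y + 5/2)))"
    by (simp add: v_def[symmetric])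
  \<comment> \<open>Both sides of \<open>U < 4/3 * y * L\<close> are affine in \<open>p\<close>; as
    \<open>p \<ge> 0\<close>, they can be compared coefficient by coefficient.\<close>
  have yL: "4/3 * y * L = p * (4/3 * y * (1 - c / 3)) + 4/3 * (1 - c / 3 - y * c - y / (3 * v\<^sup>2))"
  proof -
    have "4/3 * y * ((p + r) * (1 - c / 3) - c - z)
        = p * (4/3 * y * (1 - c / 3)) + 4/3 * (y * r * (1 - c / 3) - y * c - y * z)" for r z
      by algebra
    from this[of "1 / y" "1 / (3 * v\<^sup>2)"] show ?thesis
      using y by (simp add: L_def)
  qed
  have "4/3 * (1 - c / 3 - y * c - y / (3 * v\<^sup>2)) > b + 1 / (3 * y\<^sup>2)"
  \<comment> \<open>The bound 1/2 for \<open>y * c\<close> is too weak near 3/2, where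
    \<open>b + 1 / (3 * y\<^sup>2)\<close> is largest; up to 2 the sharper 7/20 holds.\<close>
  proof (cases "y \<le> 2")
    case True
    \<comment> \<open>At y = 2 the quotient of \<open>y * (y + 7/2)\<close> by
      \<open>(y + 3/2) * (y + 5/2)\<close> is 44/63, just below 7/10; hence the expansion with the
      factor \<open>y - 2\<close>.\<close>
    have "(3/10 * y + 13/10) * (y - 2) \<le> 0"
      using True y by (intro mult_nonneg_nonpos) auto
    moreover have "y * (y + 7/2) = 7/10 * ((y + 3/2) * (y + 5/2)) + (3/10 * y + 13/10) * (y - 2) - 1/40"
      by algebra
    ultimately have "y * (y + 7/2) \<le> 7/10 * ((y + 3/2) * (y + 5/2))"
      by linarith
    then have "y * c \<le> 7/20"
      unfolding yc using y by (simp add: pos_divide_le_eq)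
    moreover have "1 / (3 * y\<^sup>2) \<le> 1 / (3 * (3/2)\<^sup>2)"
      using y by (intro frac_le mult_mono power_mono) auto
    ultimately show ?thesis
      using b c v2 by (simp add: power2_eq_square)
  next
    case False
    have "y * (y + 7/2) \<le> (y + 3/2) * (y + 5/2)"
      using y by (simp add: algebra_simps)
    then have "y * c \<le> 1/2"
      unfolding yc using y by (simp add: pos_divide_le_eq)
    moreover have "1 / (3 * y\<^sup>2) \<le> 1 / (3 * 2\<^sup>2)"
      using False by (intro frac_le mult_mono power_mono) auto
    moreover have "b \<le> 1 / (2 * 2) + 1 / (2 * 2 * (2 + 1))"
      unfolding b_def using False by (intro add_mono frac_le mult_mono) auto
    ultimately show ?thesis
      using c v2 by simp
  qed
  moreover have "p * (4/3 * y * (1 - c / 3)) \<ge> p * (1 + b / 3)"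
  proof (rule mult_left_mono[OF _ p])
    \<comment> \<open>Here 67/72 is \<open>1 - c / 3\<close> at the extreme value
      \<open>c = 5/24\<close>.\<close>
    have "4/3 * (3/2) * (67/72) \<le> 4/3 * y * (1 - c / 3)"
      using y c by (intro mult_mono) auto
    with b show "1 + b / 3 \<le> 4/3 * y * (1 - c / 3)" by simp
  qed
  ultimately have UL: "U < 4/3 * y * L"
    unfolding yL U_def by linarith
  have b0: "0 \<le> b" using y by (simp add: b_def)
  \<comment> \<open>This yields \<open>0 < L\<close>, so that the lower bound for
    \<open>Gamma w\<close> may be multiplied by \<open>L\<close>.\<close>
  have "0 \<le> U"
    unfolding U_def using p b0 y by simp
  with UL have "0 < 4/3 * y * L" by linarith
  with y have L: "0 < L" by (simp add: zero_less_mult_iff)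

  have "Hadamard' y \<le> Gamma y * U"
    unfolding U_def p_def using y nielsen_beta_le[of y]
    by (intro Hadamard'_upper_bound) (simp_all add: b_def)
  also have "\<dots> < Gamma y * (4/3 * y * L)"
    using UL y by (intro mult_strict_left_mono) auto
  also have "\<dots> = 4/3 * y * Gamma y * L" by simp
  also have "\<dots> \<le> Gamma w * L"
    using L Gamma_lower_bound[OF y w] by (intro mult_right_mono) auto
  also have "\<dots> \<le> Gamma w * (Digamma w * (1 - c / 3) - c - 1 / (3 * w\<^sup>2))"
  proof (intro mult_left_mono)
    have "p + 1 / y = Digamma (y + 1)"
      using y Digamma_plus1[of y] by (simp add: p_def)
    also have "\<dots> \<le> Digamma w"
      using y w by (intro Digamma_real_mono) auto
    finally have "(p + 1 / y) * (1 - c / 3) \<le> Digamma w * (1 - c / 3)"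
      using c by (intro mult_right_mono) auto
    moreover have "1 / (3 * w\<^sup>2) \<le> 1 / (3 * v\<^sup>2)"
      using v by (intro frac_le mult_mono power_mono) auto
    ultimately show "L \<le> Digamma w * (1 - c / 3) - c - 1 / (3 * w\<^sup>2)"
      unfolding L_def by linarith
  qed (use w y in auto)
  also have "\<dots> \<le> Hadamard' w"
  proof (rule Hadamard'_lower_bound)
    have "nielsen_beta w \<le> 1 / (2 * w) + 1 / (2 * w * (w + 1))"
      using w y by (intro nielsen_beta_le) auto
    also have "\<dots> \<le> c"
      unfolding c_def using v by (intro add_mono frac_le mult_mono) auto
    finally show "nielsen_beta w \<le> c" .
  qed (use w y in auto)
  finally show ?thesis .
qed

section \<open>Superadditivity\<close>

text \<open>Its positive zeros are the positive solutions of the equation divided by k; see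
  \<open>k_diagonal_eq_iff\<close>.\<close>

definition diag_gap :: "real \<Rightarrow> real" where
  "diag_gap x = Hadamard (2 * x) - 2 * Hadamard x"

lemma has_field_derivative_diag_gap:
  assumes "x > 0"
  shows "(diag_gap has_field_derivative 2 * (Hadamard' (2 * x) - Hadamard' x)) (at x)"
  unfolding diag_gap_def using assms
  by (auto intro!: derivative_eq_intros DERIV_chain2[OF has_field_derivative_Hadamard]
      simp: algebra_simps)

text \<open>The derivative compares \<open>Hadamard'\<close> at \<open>2 * t\<close> and
  \<open>t\<close>, and \<open>2 * t \<ge> t + 3/2\<close> holds exactly from 3/2 on.\<close>

lemma diag_gap_strict_mono:
  assumes "3/2 \<le> x" "x < y"
  shows "diag_gap x < diag_gap y"
  using assms(2)
proof (rule DERIV_pos_imp_increasing)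
  fix t assume "x \<le> t" "t \<le> y"
  with assms have t: "3/2 \<le> t" by simp
  then have "(diag_gap has_field_derivative 2 * (Hadamard' (2 * t) - Hadamard' t)) (at t)"
    by (intro has_field_derivative_diag_gap) simp
  moreover have "2 * (Hadamard' (2 * t) - Hadamard' t) > 0"
    using t Hadamard'_less[of t "2 * t"] by simp
  ultimately show "\<exists>d. (diag_gap has_real_derivative d) (at t) \<and> 0 < d" by blast
qed

lemma diag_gap_three_halves: "diag_gap (3/2) < 0"
proof -
  have "sqrt pi \<noteq> sqrt 4"
    using pi_less_4 unfolding real_sqrt_eq_iff by simp
  then have "0 < (sqrt pi - 2)\<^sup>2" by simp
  \<comment> \<open>Expanding the square gives \<open>4 + pi > 4 * sqrt pi\<close>, that is,
    \<open>2 * Hadamard (3/2)\<close> exceeds \<open>Hadamard 3 = 2\<close>.\<close>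
  then have "2 < 2 * ((4 + pi) / (4 * sqrt pi))"
    by (simp add: power2_diff field_simps)
  then show ?thesis
    using Hadamard_Suc[of 2] by (simp only: diag_gap_def Hadamard_three_halves) simp
qed

lemma diag_gap_2: "diag_gap 2 = 4"
  using Hadamard_Suc[of 1] Hadamard_Suc[of 3] by (simp add: diag_gap_def fact_numeral)

text \<open>The sign changes on [3/2, 2]. The strict bound on \<open>a\<close> later excludes
  \<open>3/2 * k\<close> as the threshold.\<close>

lemma diag_gap_root: "\<exists>a. 3/2 < a \<and> diag_gap a = 0"
proof -
  have "\<exists>a\<ge>3/2. a \<le> 2 \<and> diag_gap a = 0"
    using diag_gap_three_halves diag_gap_2
    by (intro IVT) (auto intro!: DERIV_isCont[OF has_field_derivative_diag_gap])
  then show ?thesis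
    using diag_gap_three_halves by (metis less_eq_real_def less_irrefl)
qed

text \<open>As t runs from x to y, \<open>Hadamard (x + t) - Hadamard t\<close> does not decrease,
  its arguments being x \<ge> 3/2 apart; at t = x the claim is
  \<open>0 \<le> diag_gap x\<close>.\<close>

lemma Hadamard_superadditive_aux:
  assumes "3/2 \<le> x" "x \<le> y" "0 \<le> diag_gap x"
  shows "Hadamard x + Hadamard y \<le> Hadamard (x + y)"
proof -
  have "Hadamard (x + x) - Hadamard x \<le> Hadamard (x + y) - Hadamard y"
    using assms(2)
  proof (rule DERIV_nonneg_imp_nondecreasing)
    fix t assume t: "x \<le> t" "t \<le> y"
    have "((\<lambda>t. Hadamard (x + t) - Hadamard t) has_field_derivative
        Hadamard' (x + t) - Hadamard' t) (at t)"
      using t assms by (auto intro!: derivative_eq_intros DERIV_chain2[OF has_field_derivative_Hadamard])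
    moreover have "Hadamard' (x + t) - Hadamard' t \<ge> 0"
      using Hadamard'_less[of t "x + t"] t assms by auto
    ultimately show "\<exists>d. ((\<lambda>t. Hadamard (x + t) - Hadamard t) has_real_derivative d) (at t) \<and> 0 \<le> d"
      by blast
  qed
  with assms(3) show ?thesis by (simp add: diag_gap_def)
qed

lemma Hadamard_superadditive:
  assumes a: "3/2 \<le> a" "diag_gap a = 0" and xy: "a \<le> x" "a \<le> y"
  shows "Hadamard x + Hadamard y \<le> Hadamard (x + y)"
proof -
  have *: "0 \<le> diag_gap z" if "a \<le> z" for z
    using diag_gap_strict_mono[of a z] a that by (cases "a = z") auto
  show ?thesis
  proof (cases "x \<le> y")
    case True
    then show ?thesis using * a xy by (intro Hadamard_superadditive_aux) auto
  next
    case False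
    then show ?thesis using * a xy Hadamard_superadditive_aux[of y x] by (simp add: add.commute)
  qed
qed

section \<open>Reduction to \<open>k = 1\<close>\<close>

text \<open>The \<open>ln k\<close> term is the same at every argument and drops out of the
  difference of \<open>k_psi\<close> values in \<open>k_Hadamard_raw\<close>.\<close>

lemma k_psi_eq:
  assumes k: "k > 0" and x: "x / k \<notin> \<int>\<^sub>\<le>\<^sub>0"
  shows "k_psi k x = (ln k + Digamma (x / k)) / k"
proof -
  have "(k_Gamma k has_field_derivative k_Gamma k x * ((ln k + Digamma (x / k)) / k)) (at x)"
    unfolding k_Gamma_def using assms
    by (auto intro!: derivative_eq_intros simp: field_simps)
  moreover have "k_Gamma k x \<noteq> 0"
    using assms by (auto simp: k_Gamma_def Gamma_eq_zero_iff)
  ultimately show ?thesis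
    by (simp add: k_psi_def DERIV_imp_deriv)
qed

text \<open>With u = x / k, reflection moves 1 - u/2, 1 - (u + 1)/2 and 1 - u to u/2, (u + 1)/2 and
  u. The trigonometric terms combine to \<open>pi / (s * c)\<close>, which is
  \<open>2 * Gamma u * Gamma (1 - u)\<close>.\<close>

lemma k_Hadamard_raw_eq:
  assumes k: "k > 0" and x: "x > 0" "x / k \<notin> \<int>"
  shows "k_Hadamard_raw k x = k powr (x / k - 1) * Hadamard (x / k)"
proof -
  define u where "u = x / k"
  have u: "u > 0" "u \<notin> \<int>" and xu: "x = k * u"
    using assms by (simp_all add: u_def)
  have half: "t / 2 \<notin> \<int>" if "t \<notin> \<int>" for t :: real
    using that Ints_mult[of 2 "t / 2"] by auto
  have u1: "u + 1 \<notin> \<int>"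
    using u(2) Ints_diff[of "u + 1" 1] by auto
  note nonpole = one_minus_notin_nonpos_Ints
  define s c where "s = sin (pi * (u / 2))" and "c = cos (pi * (u / 2))"
  have sin_u: "sin (pi * u) = 2 * s * c"
    using sin_double[of "pi * (u / 2)"] by (simp add: s_def c_def)
  then have sc: "s \<noteq> 0" "c \<noteq> 0" "s\<^sup>2 + c\<^sup>2 = 1"
    using sin_pi_times_nonzero[OF u(2)] by (auto simp: s_def c_def)
  \<comment> \<open>The shift adds pi/2 to the angle, so the cotangent of the second reflection
    becomes minus a tangent.\<close>
  have shift: "sin (pi * ((u + 1) / 2)) = c" "cos (pi * ((u + 1) / 2)) = - s"
    by (simp_all add: s_def c_def add_divide_distrib distrib_left sin_add cos_add)
  have "Digamma (1 - u / 2) = Digamma (u / 2) + pi * c / s"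
    using Digamma_reflection_real[OF half[OF u(2)]] by (simp add: s_def c_def)
  moreover have "Digamma (1 - (u + 1) / 2) = Digamma ((u + 1) / 2) - pi * s / c"
    using Digamma_reflection_real[OF half[OF u1]] unfolding shift by simp
  moreover have "pi * c / s + pi * s / c = pi / (s * c)"
  proof -
    have "pi * c / s + pi * s / c = pi * (s\<^sup>2 + c\<^sup>2) / (s * c)"
      using sc(1,2) by (simp add: field_simps power2_eq_square)
    with sc(3) show ?thesis by simp
  qed
  ultimately have num: "Digamma (1 - u / 2) - Digamma (1 - (u + 1) / 2)
      = pi / (s * c) - 2 * nielsen_beta u"
    unfolding nielsen_beta_def by argo
  have "Gamma u * Gamma (1 - u) = pi / (2 * s * c)"
    by (simp add: Gamma_reflection_real sin_u)
  moreover have "Gamma (1 - u) \<noteq> 0"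
    using nonpole[OF u(2)] by (simp add: Gamma_eq_zero_iff)
  ultimately have G: "Gamma u = pi / (2 * s * c) / Gamma (1 - u)"
    by (subst eq_divide_eq) simp
  have "k_psi k (k - x / 2) = (ln k + Digamma (1 - u / 2)) / k"
    using k nonpole[OF half[OF u(2)]] k_psi_eq[OF k, of "k - x / 2"] by (simp add: xu diff_divide_distrib)
  moreover have "(k / 2 - x / 2) / k = 1 - (u + 1) / 2"
    using k by (simp add: xu field_simps)
  then have "k_psi k (k / 2 - x / 2) = (ln k + Digamma (1 - (u + 1) / 2)) / k"
    using k nonpole[OF half[OF u1]] k_psi_eq[OF k, of "k / 2 - x / 2"] by simp
  ultimately have psi: "k_psi k (k - x / 2) - k_psi k (k / 2 - x / 2)
      = (pi / (s * c) - 2 * nielsen_beta u) / k"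
    by (simp add: num[symmetric] diff_divide_distrib add_divide_distrib)
  have "(k - x) / k = 1 - u"
    using k by (simp add: xu field_simps)
  then have "k_Gamma k (k - x) = k powr (- u) * Gamma (1 - u)"
    by (simp add: k_Gamma_def)
  then have "k_Hadamard_raw k x = k powr u / k * ((pi / (s * c) - 2 * nielsen_beta u) / (2 * Gamma (1 - u)))"
    unfolding k_Hadamard_raw_def psi by (simp add: powr_minus_divide mult_ac)
  also have "k powr u / k = k powr (u - 1)"
    using k by (simp add: powr_diff)
  also have "(pi / (s * c) - 2 * nielsen_beta u) / (2 * Gamma (1 - u)) = Hadamard u"
    unfolding Hadamard_def G sin_u using sc(1,2) \<open>Gamma (1 - u) \<noteq> 0\<close> by (simp add: field_simps)
  finally show ?thesis by (simp add: u_def)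
qed

text \<open>At the multiples of k the value is a limit; the right-hand side is continuous and agrees
  with the raw formula on a punctured neighbourhood, so it supplies that limit.\<close>

lemma k_Hadamard_eq:
  assumes k: "k > 0" and x: "x > 0"
  shows "k_Hadamard k x = k powr (x / k - 1) * Hadamard (x / k)"
proof (cases "x / k \<in> \<int>")
  case False
  then have "\<not> (\<exists>n::nat. n \<ge> 1 \<and> x = real n * k)"
    using k by auto
  then show ?thesis
    using k x False unfolding k_Hadamard_def by (simp only: k_Hadamard_raw_eq if_False not_False_eq_True)
next
  case True
  then obtain m where m: "x / k = of_int m" by (elim Ints_cases)
  have "0 < x / k" using k x by simp
  then have "(0::real) < of_int m" unfolding m .
  then have "0 < m" by simp
  with m have "nat m \<ge> 1" "x = real (nat m) * k"
    using k by (auto simp: field_simps)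
  then have removable: "\<exists>n::nat. n \<ge> 1 \<and> x = real n * k" by blast
  have "isCont (\<lambda>t. k powr (t / k - 1) * Hadamard (t / k)) x"
    using k x by (intro continuous_intros isCont_o2[OF _ continuous_Hadamard]) auto
  then have lim: "((\<lambda>t. k powr (t / k - 1) * Hadamard (t / k))
      \<longlongrightarrow> k powr (x / k - 1) * Hadamard (x / k)) (at x)"
    by (simp add: isCont_def)
  \<comment> \<open>Between m - 1 and m + 1 the only integer is m.\<close>
  have "eventually (\<lambda>t. t \<in> {0<..} \<inter> {t. m - 1 < t / k \<and> t / k < m + 1}) (at x)"
    using k x m by (intro eventually_at_in_open' open_Int open_Collect_conj open_Collect_less continuous_intros) auto
  then have "eventually (\<lambda>t. k_Hadamard_raw k t = k powr (t / k - 1) * Hadamard (t / k)) (at x)"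
    using eventually_neq_at_within[of x]
  proof eventually_elim
    case (elim t)
    have "t / k \<notin> \<int>"
    proof
      assume "t / k \<in> \<int>"
      then obtain j where j: "t / k = of_int j" by (elim Ints_cases)
      with elim have "of_int (m - 1) < (of_int j :: real)" "of_int j < (of_int (m + 1) :: real)"
        by auto
      then have "j = m" unfolding of_int_less_iff by linarith
      with j m have "t / k = x / k" by simp
      with k elim show False by simp
    qed
    with elim k show ?case by (intro k_Hadamard_raw_eq) auto
  qed
  then have "(k_Hadamard_raw k \<longlongrightarrow> k powr (x / k - 1) * Hadamard (x / k)) (at x)"
    using lim by (simp add: filterlim_cong)
  then have "Lim (at x) (k_Hadamard_raw k) = k powr (x / k - 1) * Hadamard (x / k)"
    by (intro tendsto_Lim) auto
  with removable show ?thesis by (simp add: k_Hadamard_def)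
qed

text \<open>The powers of k in the inequality give all terms the common factor
  \<open>k powr ((x + y) / k - 1)\<close>, here \<open>C\<close>.\<close>

lemma k_superadditive_iff:
  assumes k: "k > 0" and xy: "x > 0" "y > 0"
  shows "k powr (y / k) * k_Hadamard k x + k powr (x / k) * k_Hadamard k y \<le> k_Hadamard k (x + y)
    \<longleftrightarrow> Hadamard (x / k) + Hadamard (y / k) \<le> Hadamard (x / k + y / k)"
proof -
  define C where "C = k powr (x / k) * k powr (y / k) / k"
  have C: "C > 0" using k by (simp add: C_def)
  have "k powr (y / k) * k_Hadamard k x + k powr (x / k) * k_Hadamard k y
      = C * (Hadamard (x / k) + Hadamard (y / k))"
    using k xy by (simp add: k_Hadamard_eq C_def powr_diff add_divide_distrib distrib_left mult_ac)
  moreover have "k_Hadamard k (x + y) = C * Hadamard (x / k + y / k)"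
    using k xy by (simp add: k_Hadamard_eq C_def powr_diff powr_add add_divide_distrib)
  ultimately show ?thesis using C by simp
qed

lemma k_diagonal_eq_iff:
  assumes k: "k > 0" and x: "x > 0"
  shows "k_Hadamard k (2 * x) = 2 * k powr (x / k) * k_Hadamard k x \<longleftrightarrow> diag_gap (x / k) = 0"
proof -
  define C where "C = k powr (x / k) * k powr (x / k) / k"
  have C: "C \<noteq> 0" using k by (simp add: C_def)
  have "k powr (2 * x / k) = k powr (x / k) * k powr (x / k)"
    by (simp flip: powr_add)
  then have "k_Hadamard k (2 * x) = C * Hadamard (2 * (x / k))"
    using k x by (simp add: k_Hadamard_eq C_def powr_diff)
  moreover have "2 * k powr (x / k) * k_Hadamard k x = C * (2 * Hadamard (x / k))"
    using k x by (simp add: k_Hadamard_eq C_def powr_diff)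
  ultimately show ?thesis
    using C unfolding diag_gap_def by (metis eq_iff_diff_eq_0 mult_left_cancel)
qed

theorem theorem4p3:
  fixes k :: real
  assumes "k > 0"
  shows "\<exists>\<alpha>\<^sub>0::real.
    (\<forall>x::real. (x \<ge> 1.5 * k \<and> k_Hadamard k (2 * x) = 2 * k powr (x / k) * k_Hadamard k x)
        \<longleftrightarrow> x = \<alpha>\<^sub>0) \<and>
    (\<forall>\<alpha>::real.
      (\<forall>x y::real. x \<ge> \<alpha> \<longrightarrow> y \<ge> \<alpha> \<longrightarrow>
         k powr (y / k) * k_Hadamard k x + k powr (x / k) * k_Hadamard k y
           \<le> k_Hadamard k (x + y))
      \<longleftrightarrow> \<alpha> \<ge> \<alpha>\<^sub>0)"
proof -
  note k = assms
  obtain a where a: "3/2 < a" "diag_gap a = 0"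
    using diag_gap_root by blast
  have sign: "diag_gap x < 0" if "3/2 \<le> x" "x < a" for x
    using diag_gap_strict_mono[OF that] a by simp
  have root: "x = a" if "3/2 \<le> x" "diag_gap x = 0" for x
    using diag_gap_strict_mono[of a x] sign[of x] a that by (cases x a rule: linorder_cases) auto
  show ?thesis
  proof (intro exI[of _ "k * a"] conjI allI)
    fix x :: real
    show "x \<ge> 1.5 * k \<and> k_Hadamard k (2 * x) = 2 * k powr (x / k) * k_Hadamard k x \<longleftrightarrow> x = k * a"
    proof
      assume *: "x \<ge> 1.5 * k \<and> k_Hadamard k (2 * x) = 2 * k powr (x / k) * k_Hadamard k x"
      then have "3/2 \<le> x / k" using k by (simp add: field_simps)
      moreover from this have "x > 0" using k by (simp add: field_simps)
      with * k have "diag_gap (x / k) = 0" by (simp add: k_diagonal_eq_iff)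
      ultimately have "x / k = a" by (rule root)
      with k show "x = k * a" by (simp add: field_simps)
    next
      assume "x = k * a"
      with a k have "x / k = a" "x > 0" "x \<ge> 1.5 * k" by simp_all
      with a k show "x \<ge> 1.5 * k \<and> k_Hadamard k (2 * x) = 2 * k powr (x / k) * k_Hadamard k x"
        by (subst k_diagonal_eq_iff) simp_all
    qed
  next
    fix \<alpha> :: real
    let ?P = "\<lambda>x y. k powr (y / k) * k_Hadamard k x + k powr (x / k) * k_Hadamard k y
      \<le> k_Hadamard k (x + y)"
    show "(\<forall>x y. x \<ge> \<alpha> \<longrightarrow> y \<ge> \<alpha> \<longrightarrow> ?P x y) \<longleftrightarrow> \<alpha> \<ge> k * a"
    proof
      assume P: "\<forall>x y. x \<ge> \<alpha> \<longrightarrow> y \<ge> \<alpha> \<longrightarrow> ?P x y"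
      \<comment> \<open>As \<alpha> may be small or negative, the diagonal is tested at a point of
        [3k/2, \<infinity>), where the sign of \<open>diag_gap\<close> is known. Since
        \<open>3/2 * k < k * a\<close>, the resulting \<open>k * a \<le> t\<close> can only come
        from \<alpha>.\<close>
      define t where "t = max \<alpha> (3/2 * k)"
      have "3/2 * k \<le> t" by (simp add: t_def)
      moreover from this have "t > 0" using k by linarith
      ultimately have t: "t > 0" "3/2 \<le> t / k"
        using k by (simp_all add: pos_le_divide_eq)
      have "t \<ge> \<alpha>" by (simp add: t_def)
      with P have "?P t t" by blast
      then have "0 \<le> diag_gap (t / k)"
        using k t k_superadditive_iff[of k t t] by (simp add: diag_gap_def)
      then have "a \<le> t / k" using sign[of "t / k"] t by fastforce
      then have "k * a \<le> t" using k by (simp add: field_simps)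
      moreover have "3/2 * k < k * a" using a k by simp
      ultimately show "\<alpha> \<ge> k * a" unfolding t_def by linarith
    next
      assume \<alpha>: "\<alpha> \<ge> k * a"
      show "\<forall>x y. x \<ge> \<alpha> \<longrightarrow> y \<ge> \<alpha> \<longrightarrow> ?P x y"
      proof (intro allI impI)
        fix x y assume "x \<ge> \<alpha>" "y \<ge> \<alpha>"
        with \<alpha> have "k * a \<le> x" "k * a \<le> y" by linarith+
        moreover have "0 < k * a" using a k by simp
        ultimately have "0 < x" "0 < y" "a \<le> x / k" "a \<le> y / k"
          using k by (auto simp: field_simps)
        with a k show "?P x y"
          by (simp add: k_superadditive_iff Hadamard_superadditive[of a])
      qed
    qed
  qed
qed

end
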